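(* Let $H$, $\{e_j\}_{j\in\mathbb Z}$, $P_m$, $\mathcal A=B_0(H)$, $W=\{W_j\}_{j\in\mathbb Z}$, $U$, $\ell_2(\mathcal A)$, $T_{U,W}$, $\tilde P_{J,m}$ and $m(\cdot)$ be as in the context. Let $J,m\in\mathbb N$. Then (i) implies (ii), where: (i) $\tilde P_{J,m}$ belongs to the closure of $\mathcal P((T_{U,W}^n)_n)$ in $\ell_2(\mathcal A)$. (ii) There exists a strictly increasing sequence $\{n_k\}_k\subseteq\mathbb N$ such that $$\lim_{k\to\infty}m\left(W_{j+n_k}W_{j+n_k-1}\cdots W_{j+1}\right)=0$$ for all $j\in[J]$.
   Context: $\mathbb N=\{1,2,\dots\}$. For $J\in\mathbb N$, $[J]:=\{-J,-J+1,\dots,J-1,J\}$. $H$ is a separable Hilbert space with an orthonormal basis $\{e_j\}_{j\in\mathbb Z}$; for $m\in\mathbb N$, $P_m$ is the orthogonal projection of $H$ onto $\mathrm{Span}\{e_{-m},\dots,e_m\}$. $B(H)$ is the $C^*$-algebra of bounded operators on $H$ and $\mathcal A:=B_0(H)$ is the $C^*$-algebra of compact operators on $H$. $W=\{W_j\}_{j\in\mathbb Z}$ is a uniformly bounded sequence of invertible operators in $B(H)$ such that $\{W_j^{-1}\}_{j\in\mathbb Z}$ is also uniformly bounded, and $U$ is a unitary operator on $H$. $\ell_2(\mathcal A)$ is the standard right Hilbert module over $\mathcal A$ indexed by $\mathbb Z$: the sequences $x=(x_j)_{j\in\mathbb Z}$ in $\mathcal A$ such that $\sum_j x_j^*x_j$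 converges in norm in $\mathcal A$, with $\langle x,y\rangle=\sum_j x_j^*y_j$ and norm $\|x\|_2=\|\langle x,x\rangle\|^{1/2}$. $T_{U,W}$ is the (bounded, invertible) linear operator on $\ell_2(\mathcal A)$ given by $(T_{U,W}(x))_\xi:=W_\xi\,x_{\xi-1}\,U$ for $\xi\in\mathbb Z$. For $R\in B(H)$, $m(R):=\sup\{C>0 : \|Rh\|\geq C\|h\|\text{ for all }h\in H\}$ (here $m(\cdot)$ is a function on operators, not to be confused with the integer $m$). For $J,m\in\mathbb N$, $\tilde P_{J,m}\in\ell_2(\mathcal A)$ is given by $(\tilde P_{J,m})_j=P_m$ for $j\in[J]$ and $(\tilde P_{J,m})_j=0$ otherwise. For a bounded linear operator $T$ on a Banach space $\mathcal X$, $\mathcal P((T^n)_n)$ denotes the set of periodic elements, i.e. of those $x\in\mathcal X$ for which there is $N\in\mathbb N$ with $T^{kN}x=x$ for all $k\in\mathbb N$. *)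

theory Defs
  imports "HOL-Analysis.Analysis"
begin

text \<open>Complex Hilbert spaces. The inner product is linear in its second argument; its real part
  is the inherited real inner product, so that norm, topology and completeness are the usual ones.\<close>

class complex_hilbert = real_inner + banach +
  fixes scaleC :: "complex \<Rightarrow> 'a \<Rightarrow> 'a"
    and cinner :: "'a \<Rightarrow> 'a \<Rightarrow> complex"
  assumes scaleC_add_right: "scaleC a (x + y) = scaleC a x + scaleC a y"
    and scaleC_add_left: "scaleC (a + b) x = scaleC a x + scaleC b x"
    and scaleC_scaleC: "scaleC a (scaleC b x) = scaleC (a * b) x"
    and scaleC_of_real: "scaleC (complex_of_real r) x = scaleR r x"
    and cinner_commute: "cinner x y = cnj (cinner y x)"
    and cinner_add_right: "cinner x (y + z) = cinner x y + cinner x z"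
    and cinner_scaleC_right: "cinner x (scaleC a y) = a * cinner x y"
    and Re_cinner: "Re (cinner x y) = inner x y"

definition cspan :: "'h::complex_hilbert set \<Rightarrow> 'h set"
  where "cspan = module.span scaleC"

definition is_onb :: "(int \<Rightarrow> 'h::complex_hilbert) \<Rightarrow> bool"
  where "is_onb e \<longleftrightarrow>
    (\<forall>i j. cinner (e i) (e j) = (if i = j then 1 else 0)) \<and> closure (cspan (range e)) = UNIV"

text \<open>The type of continuous \<^emph>\<open>real\<close>-linear maps carries the operator norm; \<open>B(H)\<close> is its subset of
  complex-linear maps.\<close>

definition bops :: "('h::complex_hilbert \<Rightarrow>\<^sub>L 'h) set"
  where "bops = {A. \<forall>c h. blinfun_apply A (scaleC c h) = scaleC c (blinfun_apply A h)}"

definition compact_ops :: "('h::complex_hilbert \<Rightarrow>\<^sub>L 'h) set"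
  where "compact_ops = {A \<in> bops. compact (closure (blinfun_apply A ` cball 0 1))}"

text \<open>Riesz representation, for the existence of adjoints.\<close>

lemma riesz:
  fixes f :: "'a::{real_inner,banach} \<Rightarrow> real"
  assumes f: "bounded_linear f"
  shows "\<exists>y. \<forall>x. f x = y \<bullet> x"
proof -
  interpret f: bounded_linear f by fact
  define Q where "Q x = x \<bullet> x - 2 * f x" for x
  obtain K where K: "\<And>x. norm (f x) \<le> norm x * K" using f.bounded by blast
  have lb: "- K\<^sup>2 \<le> Q x" for x
  proof -
    have "f x \<le> norm x * K" using K[of x] by simp
    moreover have "x \<bullet> x = (norm x)\<^sup>2" by (simp add: power2_norm_eq_inner)
    moreover have "0 \<le> (norm x - K)\<^sup>2" by simp
    ultimately show ?thesis unfolding Q_def by (simp add: power2_diff)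
  qed
  have bdd: "bdd_below (range Q)" using lb by (meson bdd_belowI2)
  define I where "I = Inf (range Q)"
  have I: "I \<le> Q x" for x unfolding I_def by (rule cInf_lower[OF _ bdd]) simp
  have "\<exists>x. Q x < I + 1 / real (Suc n)" for n
    using cInf_lessD[of "range Q" "I + 1 / real (Suc n)"] unfolding I_def by auto
  then obtain s where s: "\<And>n. Q (s n) < I + 1 / real (Suc n)" by metis
  have par: "(norm (x - y))\<^sup>2 = 2 * Q x + 2 * Q y - 4 * Q ((1/2) *\<^sub>R (x + y))" for x y
    unfolding Q_def f.scaleR f.add power2_norm_eq_inner
    by (simp add: inner_diff inner_add inner_commute algebra_simps)
  have "Cauchy s"
  proof (rule CauchyI)
    fix e :: real assume e: "0 < e"
    obtain M where M: "inverse (real (Suc M)) < e\<^sup>2 / 4" 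
      using reals_Archimedean[of "e\<^sup>2/4"] e by auto
    have "norm (s a - s b) < e" if "a \<ge> M" "b \<ge> M" for a b
    proof -
      have A: "1 / real (Suc c) \<le> inverse (real (Suc M))" if "c \<ge> M" for c
        using that by (simp add: divide_simps)
      have "(norm (s a - s b))\<^sup>2 < e\<^sup>2"
        using par[of "s a" "s b"] s[of a] s[of b] I[of "(1/2) *\<^sub>R (s a + s b)"] A[OF that(1)] A[OF that(2)] M
        by linarith
      then show ?thesis using e by (meson less_imp_le power2_less_imp_less)
    qed
    then show "\<exists>M. \<forall>m\<ge>M. \<forall>n\<ge>M. norm (s m - s n) < e" by blast
  qed
  then obtain y where y: "s \<longlonglongrightarrow> y" using Cauchy_convergent_iff convergent_def by blast
  have "(\<lambda>n. Q (s n)) \<longlonglongrightarrow> Q y" unfolding Q_def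
    by (intro tendsto_intros y f.tendsto)
  moreover have "(\<lambda>n. I + 1 / real (Suc n)) \<longlonglongrightarrow> I + 0"
    by (intro tendsto_intros LIMSEQ_Suc[OF lim_1_over_n])
  ultimately have "Q y \<le> I + 0" by (rule LIMSEQ_le) (use s less_imp_le in blast)
  then have min: "Q y \<le> Q x" for x using I[of x] by linarith
  have "f h = y \<bullet> h" for h
  proof -
    define d where "d = y \<bullet> h - f h"
    have *: "0 \<le> t\<^sup>2 * (h \<bullet> h) + 2 * t * d" for t
      using min[of "y + t *\<^sub>R h"] unfolding Q_def d_def f.add f.scaleR
      by (simp add: inner_add inner_commute power2_eq_square algebra_simps)
    have "d = 0"
    proof (rule ccontr)
      assume "d \<noteq> 0"
      define t where "t = - d / (h \<bullet> h + 1)"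
      have p: "h \<bullet> h + 1 > 0" by (simp add: add_nonneg_pos)
      have "t * (h \<bullet> h + 1) = - d" using p by (simp add: t_def)
      then have "t\<^sup>2 * (h \<bullet> h) + t\<^sup>2 = - d * t" by (metis (no_types) distrib_left mult.right_neutral power2_eq_square mult.assoc mult.commute)
      with *[of t] have "0 \<le> d * t - t\<^sup>2" by (simp add: algebra_simps)
      moreover have "d * t \<le> 0" using p by (simp add: t_def divide_simps)
      moreover have "t\<^sup>2 > 0" using \<open>d \<noteq> 0\<close> p by (simp add: t_def)
      ultimately show False by linarith
    qed
    then show ?thesis by (simp add: d_def)
  qed
  then show ?thesis by blast
qed

definition adj :: "('h::complex_hilbert \<Rightarrow>\<^sub>L 'h) \<Rightarrow> 'h \<Rightarrow>\<^sub>L 'h"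
  where "adj A = (THE B. \<forall>g h. cinner (blinfun_apply A g) h = cinner g (blinfun_apply B h))"

lemma cinner_eq: "cinner x y = Complex (x \<bullet> y) (- (x \<bullet> scaleC \<i> y))"
  using Re_cinner[of x "scaleC \<i> y"] by (simp add: complex_eq_iff Re_cinner cinner_scaleC_right)

lemma adj_ex1:
  assumes "A \<in> bops"
  shows "\<exists>!B. \<forall>g h. cinner (blinfun_apply A g) h = cinner g (blinfun_apply B h)"
proof -
  have "\<exists>y. \<forall>g. A g \<bullet> h = y \<bullet> g" for h
    by (rule riesz) (intro bounded_linear_intros)
  then obtain b where b: "\<And>h g. A g \<bullet> h = b h \<bullet> g" by metis
  have lin: "linear b"
  proof (rule linearI)
    fix x y show "b (x + y) = b x + b y"
      by (rule vector_eq_rdot[THEN iffD1]) (metis b inner_add_left inner_add_right)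
  next
    fix r x show "b (r *\<^sub>R x) = r *\<^sub>R b x"
      by (rule vector_eq_rdot[THEN iffD1]) (metis b inner_scaleR_left inner_scaleR_right)
  qed
  have bl: "bounded_linear b"
  proof -
    have "norm (b h) \<le> norm h * norm A" for h
    proof (cases "b h = 0")
      case False
      have "norm (b h) * norm (b h) = A (b h) \<bullet> h" by (simp add: b norm_eq_sqrt_inner)
      also have "\<dots> \<le> norm (A (b h)) * norm h" by (rule norm_cauchy_schwarz)
      also have "\<dots> \<le> norm A * norm (b h) * norm h" by (intro mult_right_mono norm_blinfun) auto
      finally show ?thesis using False by (simp add: mult.commute mult.left_commute)
    qed simp
    then show ?thesis using lin by (intro bounded_linear_intro[of b "norm A"]) (auto simp: linear_add linear_scale)
  qed
  have sk: "g \<bullet> scaleC \<i> h = - (scaleC \<i> g \<bullet> h)" for g h :: 'a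
    using cinner_commute[of g "scaleC \<i> h"] cinner_commute[of h "g"]
    by (simp add: Re_cinner[symmetric] cinner_scaleC_right inner_commute) (metis Re_cinner cinner_commute cinner_scaleC_right cnj.simps complex_cnj_mult Re_i_times Im_i_times minus_minus cnj.simps(2))
  have "\<forall>g h. cinner (A g) h = cinner g (Blinfun b h)"
  proof (intro allI)
    fix g h
    have "A g \<bullet> scaleC \<i> h = g \<bullet> scaleC \<i> (b h)"
    proof -
      have "A g \<bullet> scaleC \<i> h = - (A (scaleC \<i> g) \<bullet> h)" using assms by (simp only: sk bops_def mem_Collect_eq)
      also have "\<dots> = g \<bullet> scaleC \<i> (b h)" using sk[of g "b h"] b[of "scaleC \<i> g" h] inner_commute[of "b h" "scaleC \<i> g"] by linarith
      finally show ?thesis .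
    qed
    then show "cinner (A g) h = cinner g (Blinfun b h)"
      by (simp only: cinner_eq bounded_linear_Blinfun_apply[OF bl] b[of g h] inner_commute[of "b h" g])
  qed
  moreover have "B = C" if "\<forall>g h. cinner (A g) h = cinner g (blinfun_apply B h)"
    "\<forall>g h. cinner (A g) h = cinner g (blinfun_apply C h)" for B C
    by (rule blinfun_eqI, rule vector_eq_ldot[THEN iffD1]) (metis that Re_cinner)
  ultimately show ?thesis by blast
qed

definition unitary_op :: "('h::complex_hilbert \<Rightarrow>\<^sub>L 'h) \<Rightarrow> bool"
  where "unitary_op U \<longleftrightarrow> U \<in> bops \<and> adj U o\<^sub>L U = id_blinfun \<and> U o\<^sub>L adj U = id_blinfun"

definition is_inverse :: "('h::complex_hilbert \<Rightarrow>\<^sub>L 'h) \<Rightarrow> ('h \<Rightarrow>\<^sub>L 'h) \<Rightarrow> bool"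
  where "is_inverse A B \<longleftrightarrow> B \<in> bops \<and> A o\<^sub>L B = id_blinfun \<and> B o\<^sub>L A = id_blinfun"

definition op_invertible :: "('h::complex_hilbert \<Rightarrow>\<^sub>L 'h) \<Rightarrow> bool"
  where "op_invertible A \<longleftrightarrow> A \<in> bops \<and> (\<exists>B. is_inverse A B)"

definition op_inv :: "('h::complex_hilbert \<Rightarrow>\<^sub>L 'h) \<Rightarrow> 'h \<Rightarrow>\<^sub>L 'h"
  where "op_inv A = (THE B. is_inverse A B)"

definition orth_proj :: "'h::complex_hilbert set \<Rightarrow> 'h \<Rightarrow>\<^sub>L 'h"
  where "orth_proj M = (THE P. P \<in> bops \<and>
    (\<forall>h. blinfun_apply P h \<in> M \<and> (\<forall>g\<in>M. cinner g (h - blinfun_apply P h) = 0)))"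

definition basis_proj :: "(int \<Rightarrow> 'h::complex_hilbert) \<Rightarrow> nat \<Rightarrow> 'h \<Rightarrow>\<^sub>L 'h"
  where "basis_proj e m = orth_proj (cspan (e ` {- int m..int m}))"

lemma module_scaleC: "module (scaleC :: complex \<Rightarrow> 'h::complex_hilbert \<Rightarrow> 'h)"
proof
  show "scaleC 1 x = x" for x :: 'h using scaleC_of_real[of 1 x] by simp
qed (simp_all add: scaleC_add_left scaleC_add_right scaleC_scaleC)

lemma norm_scaleC: "norm (scaleC c x) = cmod c * norm (x::'h::complex_hilbert)"
proof -
  have "cinner (scaleC c x) (scaleC c x) = c * cnj (c * cinner x x)"
    using cinner_commute[of "scaleC c x" x] by (simp add: cinner_scaleC_right)
  also have "\<dots> = (c * cnj c) * cnj (cinner x x)"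
    by simp
  also have "c * cnj c = complex_of_real ((cmod c)\<^sup>2)"
    by (simp only: complex_norm_square)
  finally have "(norm (scaleC c x))\<^sup>2 = (cmod c * norm x)\<^sup>2"
    by (simp add: power2_norm_eq_inner power_mult_distrib flip: Re_cinner of_real_power)
  then show ?thesis by (simp add: power2_eq_iff_nonneg)
qed

lemma bounded_linear_scaleC: "bounded_linear (scaleC c :: 'h::complex_hilbert \<Rightarrow> 'h)"
  by (rule bounded_linear_intro[where K = "cmod c"])
    (simp_all add: scaleC_add_right scaleC_scaleC norm_scaleC mult.commute flip: scaleC_of_real)

lemma bounded_linear_cinner: "bounded_linear (cinner (g::'h::complex_hilbert))"
proof -
  have "bounded_linear (\<lambda>x. complex_of_real (g \<bullet> x) + \<i> * complex_of_real (- (g \<bullet> scaleC \<i> x)))"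
    by (intro bounded_linear_add bounded_linear_minus bounded_linear_const_mult bounded_linear_of_real[THEN bounded_linear_compose]
        bounded_linear_inner_right bounded_linear_compose[OF bounded_linear_inner_right] bounded_linear_scaleC)
  moreover have "cinner g = (\<lambda>x. complex_of_real (g \<bullet> x) + \<i> * complex_of_real (- (g \<bullet> scaleC \<i> x)))"
    by (rule ext) (simp add: cinner_eq complex_eq_iff)
  ultimately show ?thesis by simp
qed

lemma basis_proj_apply:
  fixes e :: "int \<Rightarrow> 'h::complex_hilbert"
  assumes "is_onb e"
  shows "blinfun_apply (basis_proj e m) h = (\<Sum>i\<in>{- int m..int m}. scaleC (cinner (e i) h) (e i))"
proof -
  interpret module "scaleC :: complex \<Rightarrow> 'h \<Rightarrow> 'h" by (rule module_scaleC)
  interpret c: bounded_linear "cinner g" for g :: 'h by (rule bounded_linear_cinner)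
  let ?I = "{- int m..int m}" and ?M = "cspan (e ` {- int m..int m})"
  define p where "p h = (\<Sum>i\<in>?I. scaleC (cinner (e i) h) (e i))" for h
  have on: "cinner (e i) (e j) = (if i = j then 1 else 0)" for i j
    using assms by (simp add: is_onb_def)
  have "bounded_linear (\<lambda>h. scaleC (cinner (e i) h) (e i))" for i
  proof (rule bounded_linear_intro[where K = "onorm (cinner (e i)) * norm (e i)"])
    fix x y :: 'h and r :: real
    show "scaleC (cinner (e i) (x + y)) (e i) = scaleC (cinner (e i) x) (e i) + scaleC (cinner (e i) y) (e i)"
      by (simp add: cinner_add_right scaleC_add_left)
    show "scaleC (cinner (e i) (r *\<^sub>R x)) (e i) = r *\<^sub>R scaleC (cinner (e i) x) (e i)"
      by (metis cinner_scaleC_right scaleC_of_real scaleC_scaleC)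
    have "cmod (cinner (e i) x) * norm (e i) \<le> (onorm (cinner (e i)) * norm x) * norm (e i)"
      by (intro mult_right_mono onorm bounded_linear_cinner) simp
    then show "norm (scaleC (cinner (e i) x) (e i)) \<le> norm x * (onorm (cinner (e i)) * norm (e i))"
      by (simp add: norm_scaleC mult.commute mult.left_commute)
  qed
  then have bl: "bounded_linear p" unfolding p_def by (intro bounded_linear_sum)
  have pM: "p h \<in> ?M" for h
    unfolding p_def cspan_def by (intro span_sum span_scale span_base) auto
  have orth: "cinner g (h - p h) = 0" if "g \<in> ?M" for g h
  proof -
    have 1: "cinner (e j) (h - p h) = 0" if "j \<in> ?I" for j
      using that unfolding p_def by (simp add: c.diff c.sum cinner_scaleC_right on if_distrib cong: if_cong)
    have "cinner (h - p h) g = 0"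
      using that unfolding cspan_def
    proof (induction rule: span_induct_alt)
      case base show ?case by (rule c.zero)
    next
      case (step a x y)
      then show ?case using 1 cinner_commute[of "h - p h" x]
        by (auto simp: cinner_add_right cinner_scaleC_right)
    qed
    then show ?thesis using cinner_commute[of g] by simp
  qed
  have uniq: "u = p h" if "u \<in> ?M" "\<forall>g\<in>?M. cinner g (h - u) = 0" for u h
  proof -
    have M: "u - p h \<in> ?M" using that(1) pM unfolding cspan_def by (rule span_diff)
    have "cinner (u - p h) (u - p h) = cinner (u - p h) (h - p h) - cinner (u - p h) (h - u)"
      by (simp add: c.diff)
    also have "\<dots> = 0" using M orth that(2) by simp
    finally have "(u - p h) \<bullet> (u - p h) = 0" by (simp flip: Re_cinner)
    then show ?thesis by simp
  qed
  have P: "blinfun_apply (Blinfun p) = p" by (rule bounded_linear_Blinfun_apply[OF bl])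
  have "p (scaleC c h) = scaleC c (p h)" for c h
    unfolding p_def by (simp add: cinner_scaleC_right scale_sum_right scaleC_scaleC)
  then have "basis_proj e m = Blinfun p"
    unfolding basis_proj_def orth_proj_def
    by (intro the_equality blinfun_eqI) (use pM orth uniq in \<open>auto simp: P bops_def\<close>)
  then show ?thesis by (simp add: P p_def)
qed

text \<open>Adding \<open>0\<close> only fixes the value \<open>0\<close> for operators that are not bounded below, where the set
  of positive lower bounds is empty.\<close>

definition lower_bound :: "('h::complex_hilbert \<Rightarrow>\<^sub>L 'h) \<Rightarrow> real"
  where "lower_bound R = Sup (insert 0 {C. C > 0 \<and> (\<forall>h. norm (blinfun_apply R h) \<ge> C * norm h)})"

text \<open>The Hilbert module of square-summable sequences of compact operators. The terms of
  \<open>\<langle>x,x\<rangle>\<close> are positive, so summability along finite subsets of the index set agrees with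
  norm convergence of the symmetric partial sums.\<close>

definition ell2 :: "(int \<Rightarrow> 'h::complex_hilbert \<Rightarrow>\<^sub>L 'h) set"
  where "ell2 = {x. (\<forall>j. x j \<in> compact_ops) \<and> (\<lambda>j. adj (x j) o\<^sub>L x j) summable_on UNIV}"

definition ell2_inner ::
    "(int \<Rightarrow> 'h::complex_hilbert \<Rightarrow>\<^sub>L 'h) \<Rightarrow> (int \<Rightarrow> 'h \<Rightarrow>\<^sub>L 'h) \<Rightarrow> 'h \<Rightarrow>\<^sub>L 'h"
  where "ell2_inner x y = (\<Sum>\<^sub>\<infinity>j. adj (x j) o\<^sub>L y j)"

definition ell2_norm :: "(int \<Rightarrow> 'h::complex_hilbert \<Rightarrow>\<^sub>L 'h) \<Rightarrow> real"
  where "ell2_norm x = sqrt (norm (ell2_inner x x))"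

definition ell2_closure ::
    "(int \<Rightarrow> 'h::complex_hilbert \<Rightarrow>\<^sub>L 'h) set \<Rightarrow> (int \<Rightarrow> 'h \<Rightarrow>\<^sub>L 'h) set"
  where "ell2_closure S = {x \<in> ell2. \<forall>\<epsilon>>0. \<exists>y\<in>S. ell2_norm (\<lambda>j. x j - y j) < \<epsilon>}"

definition weighted_shift ::
    "('h::complex_hilbert \<Rightarrow>\<^sub>L 'h) \<Rightarrow> (int \<Rightarrow> 'h \<Rightarrow>\<^sub>L 'h) \<Rightarrow> (int \<Rightarrow> 'h \<Rightarrow>\<^sub>L 'h) \<Rightarrow> int \<Rightarrow> 'h \<Rightarrow>\<^sub>L 'h"
  where "weighted_shift U W x = (\<lambda>\<xi>. W \<xi> o\<^sub>L x (\<xi> - 1) o\<^sub>L U)"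

definition periodic_elements :: "'x set \<Rightarrow> ('x \<Rightarrow> 'x) \<Rightarrow> 'x set"
  where "periodic_elements X T = {x \<in> X. \<exists>N\<ge>1. \<forall>k\<ge>1. (T ^^ (k * N)) x = x}"

definition trunc_proj :: "(int \<Rightarrow> 'h::complex_hilbert) \<Rightarrow> nat \<Rightarrow> nat \<Rightarrow> int \<Rightarrow> 'h \<Rightarrow>\<^sub>L 'h"
  where "trunc_proj e J m = (\<lambda>j. if j \<in> {- int J..int J} then basis_proj e m else 0)"

text \<open>\<open>weight_prod W j n\<close> is the product \<open>W (j + n) \<cdots> W (j + 2) W (j + 1)\<close>.\<close>

primrec weight_prod :: "(int \<Rightarrow> 'h::complex_hilbert \<Rightarrow>\<^sub>L 'h) \<Rightarrow> int \<Rightarrow> nat \<Rightarrow> 'h \<Rightarrow>\<^sub>L 'h"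
  where
    "weight_prod W j 0 = id_blinfun"
  | "weight_prod W j (Suc n) = W (j + int (Suc n)) o\<^sub>L weight_prod W j n"

end

theory Submission imports Defs begin

text \<open>Let \<open>x\<close> be periodic with period \<open>N\<close> and \<open>\<epsilon>\<close>-close to \<open>P\<^sub>J\<^sub>,\<^sub>m\<close>. For a multiple \<open>n > 2J\<close> of \<open>N\<close> and
  \<open>\<bar>j\<bar> \<le> J\<close>, the entry \<open>x\<^bsub>j+n\<^esub> = W\<^bsub>j+n\<^esub> \<cdots> W\<^bsub>j+1\<^esub> x\<^sub>j U\<^sup>n\<close> has norm at most \<open>\<epsilon>\<close>. Evaluating it at the
  unit vector \<open>h\<close> with \<open>U\<^sup>n h = e\<^sub>0\<close> shows that the weight product sends \<open>x\<^sub>j e\<^sub>0\<close>, a vector of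
  norm at least \<open>1 - \<epsilon>\<close>, to a vector of norm at most \<open>\<epsilon>\<close>.\<close>

lemma cinner_adj:
  assumes "A \<in> bops"
  shows "cinner (blinfun_apply A g) h = cinner g (blinfun_apply (adj A) h)"
  using theI'[OF adj_ex1[OF assms]] unfolding adj_def by blast

text \<open>This links the operator summands of \<open>ell2\<close> to squared norms of
  vectors.\<close>

lemma inner_adj_self:
  assumes "A \<in> bops"
  shows "h \<bullet> blinfun_apply (adj A o\<^sub>L A) h = (norm (blinfun_apply A h))\<^sup>2"
  using cinner_adj[OF assms, of h "blinfun_apply A h"]
  by (simp add: power2_norm_eq_inner flip: Re_cinner)

lemma bops_uminus:
  assumes "A \<in> bops"
  shows "- A \<in> bops"
proof -
  interpret c: bounded_linear "scaleC c :: 'a \<Rightarrow> 'a" for c by (rule bounded_linear_scaleC)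
  show ?thesis using assms by (simp add: bops_def uminus_blinfun.rep_eq c.neg)
qed

lemma bops_diff:
  assumes "A \<in> bops" "B \<in> bops"
  shows "A - B \<in> bops"
proof -
  interpret c: bounded_linear "scaleC c :: 'a \<Rightarrow> 'a" for c by (rule bounded_linear_scaleC)
  show ?thesis using assms by (simp add: bops_def minus_blinfun.rep_eq c.diff)
qed

lemma adj_uminus:
  assumes "A \<in> bops"
  shows "adj (- A) = - adj A"
proof -
  interpret c: bounded_linear "cinner g" for g :: 'a by (rule bounded_linear_cinner)
  have "cinner (- x) y = - cinner x y" for x y :: 'a
    by (simp add: cinner_eq complex_eq_iff)
  then have "\<forall>g h. cinner (blinfun_apply (- A) g) h = cinner g (blinfun_apply (- adj A) h)"
    by (simp add: uminus_blinfun.rep_eq c.neg cinner_adj[OF assms])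
  then show ?thesis
    unfolding adj_def[of "- A"]
    by (rule the1_equality[OF adj_ex1[OF bops_uminus[OF assms]]])
qed

text \<open>Where one sequence vanishes, the difference of two sequences is minus the other one; the
  sign then disappears from the summands.\<close>

lemma adj_uminus_self:
  assumes "A \<in> bops"
  shows "adj (- A) o\<^sub>L (- A) = adj A o\<^sub>L A"
  unfolding adj_uminus[OF assms]
  by (rule blinfun_eqI) (simp add: uminus_blinfun.rep_eq blinfun.minus_right)

text \<open>The quadratic form at a fixed \<open>h\<close> is continuous and linear in the operator,
  so it turns the sum defining \<open>ell2_inner x x\<close> into a sum of nonnegative reals. One
  term is at most the whole sum, which Cauchy-Schwarz bounds.\<close>

lemma norm_component_le_ell2_norm:
  fixes x :: "int \<Rightarrow> 'h::complex_hilbert \<Rightarrow>\<^sub>L 'h"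
  assumes bops: "\<And>i. x i \<in> bops" and summable: "(\<lambda>i. adj (x i) o\<^sub>L x i) summable_on UNIV"
  shows "norm (x j) \<le> ell2_norm x"
proof (rule norm_blinfun_bound)
  show "0 \<le> ell2_norm x" by (simp add: ell2_norm_def)
next
  fix h :: 'h
  have bl: "bounded_linear (\<lambda>A. h \<bullet> blinfun_apply A h)"
    by (intro bounded_linear_intros)
  have "((\<lambda>i. adj (x i) o\<^sub>L x i) has_sum ell2_inner x x) UNIV"
    unfolding ell2_inner_def using summable by (rule has_sum_infsum)
  from has_sum_bounded_linear[OF bl this]
  have s: "((\<lambda>i. (norm (blinfun_apply (x i) h))\<^sup>2) has_sum (h \<bullet> blinfun_apply (ell2_inner x x) h)) UNIV"
    by (simp add: inner_adj_self[OF bops, simplified] o_def)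
  have "(norm (blinfun_apply (x j) h))\<^sup>2 \<le> h \<bullet> blinfun_apply (ell2_inner x x) h"
    using finite_sum_le_has_sum[OF s, of "{j}"] by simp
  also have "\<dots> \<le> norm h * norm (blinfun_apply (ell2_inner x x) h)"
    by (rule norm_cauchy_schwarz)
  also have "\<dots> \<le> norm h * (norm (ell2_inner x x) * norm h)"
    by (intro mult_left_mono norm_blinfun) simp
  also have "\<dots> = (ell2_norm x * norm h)\<^sup>2"
    by (simp add: ell2_norm_def power2_eq_square)
  finally show "norm (blinfun_apply (x j) h) \<le> ell2_norm x * norm h"
    by (rule power2_le_imp_le) (simp add: ell2_norm_def)
qed

text \<open>Without summability of the difference, \<open>ell2_norm\<close> would be the junk value \<open>0\<close>.\<close>

lemma norm_component_diff_le_ell2_norm: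
  assumes x: "x \<in> ell2" and y: "y \<in> ell2" and "finite F" and F: "\<And>i. i \<notin> F \<Longrightarrow> x i = 0"
  shows "norm (x j - y j) \<le> ell2_norm (\<lambda>i. x i - y i)"
proof (rule norm_component_le_ell2_norm)
  have b: "x i \<in> bops" "y i \<in> bops" for i
    using x y by (auto simp: ell2_def compact_ops_def)
  show "x i - y i \<in> bops" for i by (rule bops_diff[OF b])
  have "(\<lambda>i. adj (y i) o\<^sub>L y i) summable_on - F"
    using y unfolding ell2_def
    by (auto intro: summable_on_cofin_subset simp: \<open>finite F\<close> Compl_eq_Diff_UNIV)
  \<comment> \<open>Off \<open>F\<close> the summands are exactly those of \<open>y\<close>; the
    remaining finitely many cannot affect summability.\<close>
  then have "(\<lambda>i. adj (x i - y i) o\<^sub>L (x i - y i)) summable_on - F"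
    by (rule summable_on_cong[THEN iffD1, rotated]) (simp add: F adj_uminus_self b)
  moreover have "(\<lambda>i. adj (x i - y i) o\<^sub>L (x i - y i)) summable_on F"
    using \<open>finite F\<close> by (rule summable_on_finite)
  ultimately have "(\<lambda>i. adj (x i - y i) o\<^sub>L (x i - y i)) summable_on (- F \<union> F)"
    by (rule summable_on_Un_disjoint) auto
  then show "(\<lambda>i. adj (x i - y i) o\<^sub>L (x i - y i)) summable_on UNIV"
    by simp
qed

text \<open>Each shift moves an entry one place up, adding a weight on the left and a
  \<open>U\<close> on the right.\<close>

lemma funpow_weighted_shift:
  "blinfun_apply ((weighted_shift U W ^^ n) x (j + int n)) h =
    blinfun_apply (weight_prod W j n) (blinfun_apply (x j) ((blinfun_apply U ^^ n) h))"
proof (induction n arbitrary: h)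
  case (Suc n)
  have "j + int (Suc n) - 1 = j + int n" by simp
  \<comment> \<open>The new \<open>U\<close> is the rightmost factor and acts first, so the
    induction hypothesis is taken at \<open>U h\<close>.\<close>
  then show ?case
    using Suc[of "blinfun_apply U h"] unfolding funpow.simps(2) o_def weighted_shift_def
    by (simp add: funpow_swap1)
qed simp

text \<open>Applying \<open>adj U\<close> repeatedly produces the preimage; \<open>U\<close> is
  isometric, so the norm is kept.\<close>

lemma unitary_funpow_surj:
  assumes U: "unitary_op U"
  shows "\<exists>h. (blinfun_apply U ^^ n) h = g \<and> norm h = norm g"
proof (induction n arbitrary: g)
  case (Suc n)
  have U': "U \<in> bops" "adj U o\<^sub>L U = id_blinfun" "U o\<^sub>L adj U = id_blinfun"
    using U by (auto simp: unitary_op_def)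
  have norm: "norm (blinfun_apply U h) = norm h" for h
    using inner_adj_self[OF U'(1), of h] by (simp add: U'(2) norm_eq_sqrt_inner power2_norm_eq_inner)
  have surj: "blinfun_apply U (blinfun_apply (adj U) g) = g"
    using U'(3) by (metis blinfun_apply_blinfun_compose id_blinfun.rep_eq id_apply)
  obtain h where "(blinfun_apply U ^^ n) h = blinfun_apply (adj U) g"
    "norm h = norm (blinfun_apply (adj U) g)"
    using Suc by blast
  then show ?case using surj norm by (metis funpow.simps(2) o_apply)
qed simp

text \<open>The nonzero vector caps the admissible constants. In the zero space every
  \<open>C\<close> would be admissible and \<open>Sup\<close> would be taken over an unbounded
  set.\<close>

lemma lower_bound_nonneg:
  fixes v :: "'h::complex_hilbert" and R :: "'h \<Rightarrow>\<^sub>L 'h"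
  assumes "v \<noteq> 0"
  shows "0 \<le> lower_bound R"
  unfolding lower_bound_def
proof (rule cSup_upper)
  show "bdd_above (insert 0 {C. 0 < C \<and> (\<forall>h. C * norm h \<le> norm (blinfun_apply R h))})"
    using assms by (auto intro!: bdd_aboveI[of _ "norm (blinfun_apply R v) / norm v"] simp: field_simps)
qed simp

lemma lower_bound_le:
  assumes "v \<noteq> 0"
  shows "lower_bound R \<le> norm (blinfun_apply R v) / norm v"
  unfolding lower_bound_def using assms
  by (intro cSup_least) (auto simp: field_simps)

lemma norm_onb:
  assumes "is_onb e"
  shows "norm (e i) = 1"
  using assms Re_cinner[of "e i" "e i"] by (simp add: is_onb_def norm_eq_sqrt_inner)

lemma basis_proj_onb:
  assumes "is_onb e" "\<bar>i\<bar> \<le> int m"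
  shows "blinfun_apply (basis_proj e m) (e i) = e i"
proof -
  interpret module "scaleC :: complex \<Rightarrow> 'a \<Rightarrow> 'a" by (rule module_scaleC)
  have "blinfun_apply (basis_proj e m) (e i) = (\<Sum>k\<in>{- int m..int m}. if k = i then e i else 0)"
    unfolding basis_proj_apply[OF assms(1)]
    using assms(1) by (intro sum.cong) (auto simp: is_onb_def)
  then show ?thesis using assms(2) by (auto simp: abs_le_iff)
qed

text \<open>A single periodic approximant serves all \<open>j\<close>, so one \<open>n\<close> works
  for all of them; multiples of its period exceed any \<open>M\<close>.\<close>

lemma lower_bound_weight_prod_small:
  assumes e: "is_onb e" and U: "unitary_op U"
    and cl: "trunc_proj e J m \<in> ell2_closure (periodic_elements ell2 (weighted_shift U W))"
    and "0 < \<delta>"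
  shows "\<exists>n\<ge>M. \<forall>j\<in>{- int J..int J}. lower_bound (weight_prod W j n) \<le> \<delta>"
proof -
  \<comment> \<open>The bound \<open>1 / 2\<close> will keep \<open>norm v\<close> at least
    \<open>1 / 2\<close>; the bound \<open>\<delta> / 2\<close> absorbs the division by
    \<open>norm v\<close>.\<close>
  define \<epsilon> where "\<epsilon> = min (\<delta> / 2) (1 / 2)"
  have \<epsilon>: "0 < \<epsilon>" "\<epsilon> \<le> 1 / 2" "2 * \<epsilon> \<le> \<delta>" using \<open>0 < \<delta>\<close> by (auto simp: \<epsilon>_def)
  obtain x where x: "x \<in> periodic_elements ell2 (weighted_shift U W)"
    and close: "ell2_norm (\<lambda>j. trunc_proj e J m j - x j) < \<epsilon>"
    using cl \<epsilon>(1) unfolding ell2_closure_def by blast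
  obtain N where "N \<ge> 1" and N: "\<And>k. k \<ge> 1 \<Longrightarrow> (weighted_shift U W ^^ (k * N)) x = x"
    using x unfolding periodic_elements_def by blast
  have comp: "norm (trunc_proj e J m j - x j) \<le> \<epsilon>" for j
  proof -
    have "norm (trunc_proj e J m j - x j) \<le> ell2_norm (\<lambda>j. trunc_proj e J m j - x j)"
    proof (rule norm_component_diff_le_ell2_norm)
      show "trunc_proj e J m \<in> ell2" using cl by (simp add: ell2_closure_def)
      show "x \<in> ell2" using x by (simp add: periodic_elements_def)
      show "finite {- int J..int J}" by simp
      show "trunc_proj e J m i = 0" if "i \<notin> {- int J..int J}" for i
        using that by (auto simp: trunc_proj_def)
    qed
    then show ?thesis using close by simp
  qed
  \<comment> \<open>As \<open>j\<close> is at least \<open>- J\<close>, the summand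
    \<open>2 * J + 1\<close> pushes \<open>j + n\<close> beyond \<open>J\<close>, where
    \<open>trunc_proj e J m\<close> is zero.\<close>
  define n where "n = (M + 2 * J + 1) * N"
  have n: "n \<ge> M + 2 * J + 1" and per: "(weighted_shift U W ^^ n) x = x"
    using mult_le_mono2[OF \<open>N \<ge> 1\<close>, of "M + 2 * J + 1"] N[of "M + 2 * J + 1"]
    by (simp_all add: n_def)
  have "lower_bound (weight_prod W j n) \<le> \<delta>" if j: "j \<in> {- int J..int J}" for j
  proof -
    obtain h where h: "(blinfun_apply U ^^ n) h = e 0" "norm h = 1"
      using unitary_funpow_surj[OF U, of n "e 0"] norm_onb[OF e] by metis
    define v where "v = blinfun_apply (x j) (e 0)"
    have "norm (e 0 - v) \<le> norm (trunc_proj e J m j - x j)"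
      using norm_blinfun[of "trunc_proj e J m j - x j" "e 0"] basis_proj_onb[OF e, of 0 m] j
      by (simp add: trunc_proj_def v_def minus_blinfun.rep_eq norm_onb[OF e])
    then have v: "norm v \<ge> 1 / 2"
      using comp[of j] \<epsilon>(2) norm_triangle_ineq2[of "e 0" v] norm_onb[OF e, of 0] by linarith
    have "trunc_proj e J m (j + int n) = 0"
      using j n by (simp add: trunc_proj_def)
    then have "norm (x (j + int n)) \<le> \<epsilon>" using comp[of "j + int n"] by simp
    moreover have "blinfun_apply (weight_prod W j n) v = blinfun_apply (x (j + int n)) h"
      using funpow_weighted_shift[of n U W x j h] by (simp add: per h v_def)
    ultimately have Wv: "norm (blinfun_apply (weight_prod W j n) v) \<le> \<epsilon>"
      using norm_blinfun[of "x (j + int n)" h] h(2) by simp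
    have "v \<noteq> 0" using v by auto
    then have "lower_bound (weight_prod W j n) \<le> norm (blinfun_apply (weight_prod W j n) v) / norm v"
      by (rule lower_bound_le)
    also have "\<dots> \<le> \<epsilon> / (1 / 2)" using Wv v \<epsilon>(1) by (intro frac_le) auto
    also have "\<dots> \<le> \<delta>" using \<epsilon>(3) by simp
    finally show ?thesis .
  qed
  moreover have "n \<ge> M" using n by simp
  ultimately show ?thesis by blast
qed

text \<open>The indices are chosen recursively, the \<open>k\<close>-th with tolerance
  \<open>1 / (k + 1)\<close> for all of \<open>F\<close> at once and each beyond its
  predecessor.\<close>

lemma common_vanishing_subsequence:
  fixes f :: "'a \<Rightarrow> nat \<Rightarrow> real"
  assumes nonneg: "\<And>j n. 0 \<le> f j n"
    and small: "\<And>\<delta> M. 0 < \<delta> \<Longrightarrow> \<exists>n\<ge>M. \<forall>j\<in>F. f j n \<le> \<delta>"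
  shows "\<exists>n. strict_mono n \<and> (\<forall>k. n k \<ge> 1) \<and> (\<forall>j\<in>F. (\<lambda>k. f j (n k)) \<longlonglongrightarrow> 0)"
proof -
  define Q where "Q k n \<longleftrightarrow> n \<ge> 1 \<and> (\<forall>j\<in>F. f j n \<le> 1 / real (Suc k))" for k n
  have ex: "\<exists>n. Q k n \<and> M < n" for k M
  proof -
    have pos: "0 < 1 / real (Suc k)" by simp
    \<comment> \<open>Asking for \<open>Suc M\<close> gives both \<open>M < n\<close> and
      \<open>n \<ge> 1\<close>.\<close>
    obtain n where "n \<ge> Suc M" "\<forall>j\<in>F. f j n \<le> 1 / real (Suc k)"
      using small[OF pos, of "Suc M"] by auto
    then have "Q k n \<and> M < n" by (simp add: Q_def)
    then show ?thesis ..
  qed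
  have "\<exists>n. \<forall>k. Q k (n k) \<and> n k < n (Suc k)"
  proof (rule dependent_nat_choice)
    show "\<exists>n. Q 0 n" using ex[of 0 0] by blast
    show "\<exists>n'. Q (Suc k) n' \<and> n < n'" for n k by (rule ex)
  qed
  then obtain n where n: "\<And>k. Q k (n k)" "\<And>k. n k < n (Suc k)" by blast
  have "(\<lambda>k. f j (n k)) \<longlonglongrightarrow> 0" if "j \<in> F" for j
  proof (rule tendsto_sandwich)
    show "\<forall>\<^sub>F k in sequentially. 0 \<le> f j (n k)" by (simp add: nonneg)
    show "\<forall>\<^sub>F k in sequentially. f j (n k) \<le> 1 / real (Suc k)"
      using n(1) that unfolding Q_def by (intro always_eventually) blast
    show "(\<lambda>k. 1 / real (Suc k)) \<longlonglongrightarrow> 0" by (rule LIMSEQ_Suc[OF lim_1_over_n])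
  qed simp
  moreover have "strict_mono n" using n(2) by (simp add: strict_mono_Suc_iff)
  moreover have "n k \<ge> 1" for k using n(1) by (simp add: Q_def)
  ultimately show ?thesis by blast
qed

theorem proposition3p7:
  fixes e :: "int \<Rightarrow> 'h::complex_hilbert"
    and W :: "int \<Rightarrow> 'h \<Rightarrow>\<^sub>L 'h"
    and U :: "'h \<Rightarrow>\<^sub>L 'h"
    and J m :: nat
  assumes "is_onb e"
    and "\<forall>j. op_invertible (W j)"
    and "bounded (range W)"
    and "bounded (range (\<lambda>j. op_inv (W j)))"
    and "unitary_op U"
    and "J \<ge> 1" and "m \<ge> 1"
  shows "trunc_proj e J m \<in> ell2_closure (periodic_elements ell2 (weighted_shift U W)) \<longrightarrow>
    (\<exists>n :: nat \<Rightarrow> nat. strict_mono n \<and> (\<forall>k. n k \<ge> 1) \<and>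
      (\<forall>j \<in> {- int J..int J}. (\<lambda>k. lower_bound (weight_prod W j (n k))) \<longlonglongrightarrow> 0))"
proof
  assume cl: "trunc_proj e J m \<in> ell2_closure (periodic_elements ell2 (weighted_shift U W))"
  \<comment> \<open>This provides the nonzero vector that \<open>lower_bound_nonneg\<close>
    requires.\<close>
  have "e 0 \<noteq> 0" using norm_onb[OF assms(1), of 0] by auto
  then show "\<exists>n :: nat \<Rightarrow> nat. strict_mono n \<and> (\<forall>k. n k \<ge> 1) \<and>
      (\<forall>j \<in> {- int J..int J}. (\<lambda>k. lower_bound (weight_prod W j (n k))) \<longlonglongrightarrow> 0)"
    by (intro common_vanishing_subsequence lower_bound_nonneg
        lower_bound_weight_prod_small[OF assms(1,5) cl])
qed

end
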